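(* Let $\mathcal{H}$ be a Hilbert space and let $f,g:\mathcal{H}\to(-\infty,\infty]$ be closed, proper, convex functions with $\operatorname{zer}(\partial f+\partial g)\neq\emptyset$. Let $\gamma>0$, $z^0\in\mathcal{H}$, and $\lambda_k\in(0,1]$ for all $k\ge0$, and let $(z^j)_{j\ge0}$ be generated by the relaxed Peaceman-Rachford iteration $z^{k+1}=(1-\lambda_k)z^k+\lambda_kT_{\mathrm{PRS}}(z^k)$. Let $z^\ast$ be an arbitrary fixed point of $T_{\mathrm{PRS}}$ and $x^\ast:=\mathbf{prox}_{\gamma g}(z^\ast)$. Then for all $k\ge0$, $$-\frac{2\|z^0-z^\ast\|\|z^\ast-x^\ast\|}{\gamma\Lambda_k}\le f(\overline{x}_f^k)+g(\overline{x}_g^k)-f(x^\ast)-g(x^\ast)\le\frac{1}{4\gamma\Lambda_k}\|z^0-x^\ast\|^2.$$ In addition, the following feasibility bound holds: $$\|\overline{x}_g^k-\overline{x}_f^k\|\le\frac{2\|z^0-z^\ast\|}{\Lambda_k}.$$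
   Context: $\mathbf{prox}_{\gamma f}(x):=\arg\min_{y\in\mathcal{H}}f(y)+\frac{1}{2\gamma}\|y-x\|^2$, $\mathbf{refl}_{\gamma f}:=2\mathbf{prox}_{\gamma f}-I_{\mathcal{H}}$, $T_{\mathrm{PRS}}:=\mathbf{refl}_{\gamma f}\circ\mathbf{refl}_{\gamma g}$. The auxiliary points are $x_g^k:=\mathbf{prox}_{\gamma g}(z^k)$ and $x_f^k:=\mathbf{prox}_{\gamma f}(\mathbf{refl}_{\gamma g}(z^k))$. $\Lambda_k:=\sum_{i=0}^k\lambda_i$, $\overline{x}_f^k:=\frac{1}{\Lambda_k}\sum_{i=0}^k\lambda_ix_f^i$, $\overline{x}_g^k:=\frac{1}{\Lambda_k}\sum_{i=0}^k\lambda_ix_g^i$. The point $x^\ast$ is a minimizer of $f+g$. $\operatorname{zer}(A)=\{x\mid 0\in Ax\}$. *)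

theory Defs
  imports "HOL-Analysis.Analysis"
begin

section \<open>Extended-real-valued convex functions\<close>

(* Functions H -> (-infinity, infinity] have codomain ereal; the value -infinity is excluded
   by proper_fun. *)

definition proper_fun :: "('a \<Rightarrow> ereal) \<Rightarrow> bool" where
  "proper_fun f \<longleftrightarrow> (\<forall>x. f x \<noteq> -\<infinity>) \<and> (\<exists>x. f x \<noteq> \<infinity>)"

definition closed_fun :: "('a::real_normed_vector \<Rightarrow> ereal) \<Rightarrow> bool" where
  "closed_fun f \<longleftrightarrow> closed {(x, r::real). f x \<le> ereal r}"

(* Only 0 < t < 1, so that the ereal convention 0 * infinity = 0 plays no role. *)
definition convex_fun :: "('a::real_vector \<Rightarrow> ereal) \<Rightarrow> bool" where
  "convex_fun f \<longleftrightarrow>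
    (\<forall>x y t. 0 < t \<and> t < 1 \<longrightarrow>
      f ((1 - t) *\<^sub>R x + t *\<^sub>R y) \<le> ereal (1 - t) * f x + ereal t * f y)"

(* For proper f this is empty at points where f is infinite. *)
definition subdifferential :: "('a::real_inner \<Rightarrow> ereal) \<Rightarrow> 'a \<Rightarrow> 'a set" where
  "subdifferential f x = {u. \<forall>y. f x + ereal ((y - x) \<bullet> u) \<le> f y}"

definition zer :: "('a \<Rightarrow> 'b::zero set) \<Rightarrow> 'a set" where
  "zer A = {x. 0 \<in> A x}"


section \<open>Proximal and reflection operators, Peaceman-Rachford splitting\<close>

definition prox :: "real \<Rightarrow> ('a::real_inner \<Rightarrow> ereal) \<Rightarrow> 'a \<Rightarrow> 'a" where
  "prox \<gamma> f x = arg_min (\<lambda>y. f y + ereal (1 / (2 * \<gamma>) * (norm (y - x))\<^sup>2)) (\<lambda>_. True)"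

definition refl_op :: "real \<Rightarrow> ('a::real_inner \<Rightarrow> ereal) \<Rightarrow> 'a \<Rightarrow> 'a" where
  "refl_op \<gamma> f x = 2 *\<^sub>R prox \<gamma> f x - x"

definition T_PRS :: "real \<Rightarrow> ('a::real_inner \<Rightarrow> ereal) \<Rightarrow> ('a \<Rightarrow> ereal) \<Rightarrow> 'a \<Rightarrow> 'a" where
  "T_PRS \<gamma> f g = refl_op \<gamma> f \<circ> refl_op \<gamma> g"

definition aux_g :: "real \<Rightarrow> ('a::real_inner \<Rightarrow> ereal) \<Rightarrow> (nat \<Rightarrow> 'a) \<Rightarrow> nat \<Rightarrow> 'a" where
  "aux_g \<gamma> g z k = prox \<gamma> g (z k)"

definition aux_f ::
  "real \<Rightarrow> ('a::real_inner \<Rightarrow> ereal) \<Rightarrow> ('a \<Rightarrow> ereal) \<Rightarrow> (nat \<Rightarrow> 'a) \<Rightarrow> nat \<Rightarrow> 'a" where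
  "aux_f \<gamma> f g z k = prox \<gamma> f (refl_op \<gamma> g (z k))"

definition cum_weight :: "(nat \<Rightarrow> real) \<Rightarrow> nat \<Rightarrow> real" where
  "cum_weight lam k = (\<Sum>i=0..k. lam i)"

definition ergodic_avg :: "(nat \<Rightarrow> real) \<Rightarrow> (nat \<Rightarrow> 'a::real_vector) \<Rightarrow> nat \<Rightarrow> 'a" where
  "ergodic_avg lam x k = (1 / cum_weight lam k) *\<^sub>R (\<Sum>i=0..k. lam i *\<^sub>R x i)"

end

theory Submission
  imports Defs
begin

text \<open>
  The inclusion \<open>0 \<in> \<partial>f x + \<partial>g x\<close> provides affine minorants of \<open>f\<close> and \<open>g\<close>, so the proximal
  objectives are bounded below and strongly convex and attain their minima. With
  \<open>d\<^sub>k = x\<^sub>f\<^sup>k - x\<^sub>g\<^sup>k\<close> one has \<open>z\<^sup>k\<^sup>+\<^sup>1 = z\<^sup>k + 2 \<lambda>\<^sub>k d\<^sub>k\<close>. The subgradient inequalities at \<open>x\<^sub>f\<^sup>k\<close> and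
  \<open>x\<^sub>g\<^sup>k\<close> bound \<open>4 \<gamma> \<lambda>\<^sub>k\<close> times the objective error by
  \<open>\<parallel>z\<^sup>k - x\<^sup>*\<parallel>\<^sup>2 - \<parallel>z\<^sup>k\<^sup>+\<^sup>1 - x\<^sup>*\<parallel>\<^sup>2\<close>, which telescopes; Jensen's inequality gives the upper bound. The
  feasibility gap equals \<open>(z\<^sup>0 - z\<^sup>k\<^sup>+\<^sup>1) / (2 \<Lambda>\<^sub>k)\<close>, which is controlled by Fejer monotonicity with
  respect to \<open>z\<^sup>*\<close>. The lower bound follows from the subgradient inequalities at \<open>x\<^sup>*\<close>, where the two
  proximal subgradients are opposite.
\<close>

section \<open>Convexity and subgradients of extended-real functions\<close>

text \<open>Passing to the epigraph replaces extended-real inequalities by a convex set in a real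
  vector space, where finite convex combinations and midpoints are available. The endpoints are
  treated apart because \<open>convex_fun\<close> only speaks of \<open>0 < t < 1\<close>.\<close>

lemma convex_epigraph:
  assumes "convex_fun f"
  shows "convex {(x, r::real). f x \<le> ereal r}"
  unfolding convex_alt
proof (intro ballI allI impI)
  fix p q :: "'a \<times> real" and t :: real
  assume p: "p \<in> {(x, r). f x \<le> ereal r}" and q: "q \<in> {(x, r). f x \<le> ereal r}"
    and t: "0 \<le> t \<and> t \<le> 1"
  obtain x a y b where pq: "p = (x, a)" "q = (y, b)" by (metis surj_pair)
  have xa: "f x \<le> ereal a" and yb: "f y \<le> ereal b" using p q pq by auto
  consider "t = 0" | "t = 1" | "0 < t" "t < 1" using t by linarith
  then show "(1 - t) *\<^sub>R p + t *\<^sub>R q \<in> {(x, r). f x \<le> ereal r}"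
  proof cases
    case 3
    have "f ((1 - t) *\<^sub>R x + t *\<^sub>R y) \<le> ereal (1 - t) * f x + ereal t * f y"
      using assms 3 unfolding convex_fun_def by blast
    also have "\<dots> \<le> ereal (1 - t) * ereal a + ereal t * ereal b"
      using 3 xa yb by (intro add_mono ereal_mult_left_mono) auto
    finally show ?thesis using pq by simp
  qed (use xa yb pq in auto)
qed

text \<open>Jensen's inequality, obtained from a convex combination of points of the epigraph. Real
  majorants \<open>r i\<close> in place of the values of \<open>f\<close> keep the right-hand sum in
  the reals.\<close>

lemma convex_fun_sum_le:
  assumes "convex_fun f" "finite I" "\<And>i. i \<in> I \<Longrightarrow> 0 \<le> a i" "sum a I = 1"
    and "\<And>i. i \<in> I \<Longrightarrow> f (x i) \<le> ereal (r i)"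
  shows "f (\<Sum>i\<in>I. a i *\<^sub>R x i) \<le> ereal (\<Sum>i\<in>I. a i * r i)"
proof -
  have "(\<Sum>i\<in>I. a i *\<^sub>R (x i, r i)) \<in> {(x, r::real). f x \<le> ereal r}"
    by (rule convex_sum[OF assms(2) convex_epigraph[OF assms(1)] assms(4,3)]) (use assms(5) in auto)
  moreover have "(\<Sum>i\<in>I. a i *\<^sub>R (x i, r i)) = (\<Sum>i\<in>I. a i *\<^sub>R x i, \<Sum>i\<in>I. a i * r i)"
    by (simp add: prod_eq_iff fst_sum snd_sum)
  ultimately show ?thesis by auto
qed

lemma subdifferential_finite:
  assumes "proper_fun f" "u \<in> subdifferential f x"
  obtains r where "f x = ereal r"
proof -
  obtain y where "f y \<noteq> \<infinity>" using assms(1) unfolding proper_fun_def by blast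
  moreover have "f x + ereal ((y - x) \<bullet> u) \<le> f y"
    using assms(2) unfolding subdifferential_def by blast
  ultimately have "f x \<noteq> \<infinity>" by auto
  moreover have "f x \<noteq> -\<infinity>" using assms(1) unfolding proper_fun_def by blast
  ultimately show thesis using that by (cases "f x") auto
qed

lemma subdifferentialD:
  assumes "u \<in> subdifferential f x" "f x = ereal a" "f y \<le> ereal b"
  shows "a + (y - x) \<bullet> u \<le> b"
proof -
  have "f x + ereal ((y - x) \<bullet> u) \<le> f y"
    using assms(1) unfolding subdifferential_def by blast
  also note assms(3)
  finally show ?thesis using assms(2) by simp
qed

lemma norm_add_square:
  fixes x y :: "'a::real_inner"
  shows "(norm (x + y))\<^sup>2 = (norm x)\<^sup>2 + 2 * (x \<bullet> y) + (norm y)\<^sup>2"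
  by (simp add: power2_norm_eq_inner inner_add_left inner_add_right inner_commute)

section \<open>Existence of proximal points\<close>

text \<open>A subgradient at \<open>w\<close> gives an affine minorant of \<open>f\<close>, and an
  affine function plus the proximal quadratic is bounded below.\<close>

lemma prox_objective_bounded_below:
  fixes f :: "'a::real_inner \<Rightarrow> ereal"
  assumes "proper_fun f" "subdifferential f w \<noteq> {}" "\<gamma> > 0"
  obtains c where "\<And>y r. f y \<le> ereal r \<Longrightarrow> c \<le> r + 1 / (2 * \<gamma>) * (norm (y - x))\<^sup>2"
proof -
  obtain u where u: "u \<in> subdifferential f w" using assms(2) by blast
  obtain a where a: "f w = ereal a" using subdifferential_finite[OF assms(1) u] .
  \<comment> \<open>The constant is the minimum over \<open>y\<close> of the affine minorant plus
    the quadratic, attained at \<open>y = x - \<gamma> *\<^sub>R u\<close>; completing the square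
    shows it.\<close>
  have "a + (x - w) \<bullet> u - \<gamma> / 2 * (norm u)\<^sup>2 \<le> r + 1 / (2 * \<gamma>) * (norm (y - x))\<^sup>2"
    if "f y \<le> ereal r" for y r
  proof -
    have "0 \<le> (norm ((y - x) + \<gamma> *\<^sub>R u))\<^sup>2 / (2 * \<gamma>)"
      using assms(3) by simp
    also have "\<dots> = (norm (y - x))\<^sup>2 / (2 * \<gamma>) + (y - x) \<bullet> u + \<gamma> / 2 * (norm u)\<^sup>2"
      using assms(3) unfolding norm_add_square
      by (simp add: power_mult_distrib power2_eq_square add_divide_distrib)
    finally have "0 \<le> (norm (y - x))\<^sup>2 / (2 * \<gamma>) + (y - x) \<bullet> u + \<gamma> / 2 * (norm u)\<^sup>2" .
    moreover have "a + (y - w) \<bullet> u \<le> r" using subdifferentialD[OF u a that] .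
    moreover have "(y - w) \<bullet> u = (y - x) \<bullet> u + (x - w) \<bullet> u" by (simp add: inner_diff_left)
    ultimately show ?thesis by simp
  qed
  then show thesis using that by blast
qed

text \<open>Strong convexity makes every minimizing sequence Cauchy; completeness gives a limit, and
  the closed epigraph contains it. The real number \<open>m\<close> also records that the minimum is
  finite.\<close>

lemma prox_objective_attains_min:
  fixes f :: "'a::{real_inner, complete_space} \<Rightarrow> ereal"
  assumes f: "closed_fun f" "proper_fun f" "convex_fun f"
    and sub: "subdifferential f w \<noteq> {}" and gamma: "\<gamma> > 0"
  shows "\<exists>p m. f p + ereal (1 / (2 * \<gamma>) * (norm (p - x))\<^sup>2) \<le> ereal m \<and>
    (\<forall>y. ereal m \<le> f y + ereal (1 / (2 * \<gamma>) * (norm (y - x))\<^sup>2))"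
proof -
  \<comment> \<open>Minimizing over the epigraph, with \<open>r\<close> standing for the value of
    \<open>f\<close>, makes the objective \<open>h\<close> real-valued and continuous.\<close>
  define E where "E = {(y, r::real). f y \<le> ereal r}"
  define h where "h = (\<lambda>(y, r::real). r + 1 / (2 * \<gamma>) * (norm (y - x))\<^sup>2)"
  define m where "m = Inf (h ` E)"
  obtain c where "\<And>y r. f y \<le> ereal r \<Longrightarrow> c \<le> r + 1 / (2 * \<gamma>) * (norm (y - x))\<^sup>2"
    using prox_objective_bounded_below[OF f(2) sub gamma] by metis
  then have bdd: "bdd_below (h ` E)"
    by (intro bdd_belowI[of _ c]) (auto simp: E_def h_def)
  have m_le: "m \<le> h e" if "e \<in> E" for e
    unfolding m_def using bdd that by (intro cInf_lower) auto
  obtain u where u: "u \<in> subdifferential f w" using sub by blast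
  obtain a where "f w = ereal a" using subdifferential_finite[OF f(2) u] .
  then have "(w, a) \<in> E" by (simp add: E_def)
  then have ne: "h ` E \<noteq> {}" by blast
  have "\<exists>e. e \<in> E \<and> h e < m + 1 / real (Suc n)" for n
    using cInf_lessD[OF ne, of "m + 1 / real (Suc n)"] unfolding m_def by fastforce
  then obtain e where e: "\<And>n. e n \<in> E" and he: "\<And>n. h (e n) < m + 1 / real (Suc n)"
    by metis
  \<comment> \<open>By the parallelogram identity the midpoint of \<open>p\<close> and
    \<open>q\<close> lies below the average of \<open>h\<close> by a multiple of their squared
    distance. Since it cannot go below \<open>m\<close>, almost minimal points are close
    together.\<close>
  have par: "(norm (fst p - fst q))\<^sup>2 \<le> 4 * \<gamma> * (h p + h q - 2 * m)"
    if "p \<in> E" "q \<in> E" for p q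
  proof -
    obtain y r z s where pq: "p = (y, r)" "q = (z, s)" by (metis surj_pair)
    have "(1/2) *\<^sub>R p + (1/2) *\<^sub>R q \<in> E"
      using convex_epigraph[OF f(3)] that unfolding E_def[symmetric] convex_def by auto
    then have "m \<le> h ((1/2) *\<^sub>R p + (1/2) *\<^sub>R q)" by (rule m_le)
    also have "\<dots> = (h p + h q) / 2 - (norm (fst p - fst q))\<^sup>2 / (8 * \<gamma>)"
    proof -
      have mid: "(norm ((1/2) *\<^sub>R y + (1/2) *\<^sub>R z - x))\<^sup>2
          = ((norm (y - x))\<^sup>2 + (norm (z - x))\<^sup>2) / 2 - (norm (y - z))\<^sup>2 / 4"
        unfolding power2_norm_eq_inner
        by (simp add: inner_add_left inner_add_right inner_diff_left inner_diff_right
            inner_commute[of z y] inner_commute[of x y] inner_commute[of x z] field_simps)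
      have "h ((1/2) *\<^sub>R p + (1/2) *\<^sub>R q)
          = (r + s) / 2 + 1 / (2 * \<gamma>) * (norm ((1/2) *\<^sub>R y + (1/2) *\<^sub>R z - x))\<^sup>2"
        unfolding pq h_def by simp
      then show ?thesis
        unfolding mid unfolding pq h_def by (simp add: add_divide_distrib diff_divide_distrib algebra_simps)
    qed
    finally show ?thesis using gamma by (simp add: field_simps)
  qed
  have e_lim: "(\<lambda>n. h (e n)) \<longlonglongrightarrow> m"
  proof (rule tendsto_sandwich[of "\<lambda>_. m" _ _ "\<lambda>n. m + 1 / real (Suc n)"])
    show "(\<lambda>n. m + 1 / real (Suc n)) \<longlonglongrightarrow> m"
      using tendsto_add[OF tendsto_const LIMSEQ_Suc[OF lim_1_over_n], of m] by simp
  qed (use m_le e he in \<open>auto intro!: always_eventually simp: less_imp_le\<close>)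
  have "Cauchy (\<lambda>n. fst (e n))"
  proof (rule metric_CauchyI)
    fix \<epsilon> :: real assume "\<epsilon> > 0"
    then have "\<epsilon>\<^sup>2 / (8 * \<gamma>) > 0" using gamma by simp
    then obtain N where N: "\<And>n. n \<ge> N \<Longrightarrow> dist (h (e n)) m < \<epsilon>\<^sup>2 / (8 * \<gamma>)"
      using e_lim unfolding lim_sequentially by blast
    have "dist (fst (e i)) (fst (e j)) < \<epsilon>" if "i \<ge> N" "j \<ge> N" for i j
    proof -
      have "h (e i) + h (e j) - 2 * m < \<epsilon>\<^sup>2 / (4 * \<gamma>)"
        using N[OF that(1)] N[OF that(2)] by (simp add: dist_real_def abs_less_iff)
      then have "4 * \<gamma> * (h (e i) + h (e j) - 2 * m) < \<epsilon>\<^sup>2"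
        using gamma by (simp add: field_simps)
      then have "(norm (fst (e i) - fst (e j)))\<^sup>2 < \<epsilon>\<^sup>2" using par[OF e e, of i j] by linarith
      then show ?thesis using \<open>\<epsilon> > 0\<close> by (simp add: dist_norm power_less_imp_less_base)
    qed
    then show "\<exists>M. \<forall>i\<ge>M. \<forall>j\<ge>M. dist (fst (e i)) (fst (e j)) < \<epsilon>" by blast
  qed
  then obtain p where p: "(\<lambda>n. fst (e n)) \<longlonglongrightarrow> p"
    using Cauchy_convergent convergent_def by blast
  \<comment> \<open>The limit forced on the second coordinates: both \<open>h (e n)\<close> and the
    quadratic term converge, hence so does their difference.\<close>
  define r where "r = m - 1 / (2 * \<gamma>) * (norm (p - x))\<^sup>2"
  have "(\<lambda>n. h (e n) - 1 / (2 * \<gamma>) * (norm (fst (e n) - x))\<^sup>2) \<longlonglongrightarrow> r"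
    unfolding r_def by (intro tendsto_intros e_lim p)
  then have "(\<lambda>n. snd (e n)) \<longlonglongrightarrow> r" by (simp add: h_def split_beta)
  then have "e \<longlonglongrightarrow> (p, r)" using tendsto_Pair[OF p, of "\<lambda>n. snd (e n)" r] by simp
  then have "(p, r) \<in> E"
    using f(1) e closed_sequentially[of E e] unfolding closed_fun_def E_def by blast
  then have "f p + ereal (1 / (2 * \<gamma>) * (norm (p - x))\<^sup>2)
      \<le> ereal r + ereal (1 / (2 * \<gamma>) * (norm (p - x))\<^sup>2)"
    unfolding E_def by (intro add_right_mono) auto
  moreover have "ereal m \<le> f y + ereal (1 / (2 * \<gamma>) * (norm (y - x))\<^sup>2)" for y
  proof (cases "f y")
    case (real s)
    then show ?thesis using m_le[of "(y, s)"] by (simp add: E_def h_def)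
  qed (use f(2) in \<open>auto simp: proper_fun_def\<close>)
  ultimately show ?thesis unfolding r_def by auto
qed

text \<open>As \<open>prox\<close> is a choice by \<open>arg_min\<close>, it has the minimizing
  property only once some minimizer is known to exist.\<close>

lemma prox_minimizes:
  fixes f :: "'a::{real_inner, complete_space} \<Rightarrow> ereal"
  assumes "closed_fun f" "proper_fun f" "convex_fun f"
    and "subdifferential f w \<noteq> {}" and "\<gamma> > 0"
  shows "f (prox \<gamma> f x) + ereal (1 / (2 * \<gamma>) * (norm (prox \<gamma> f x - x))\<^sup>2)
    \<le> f y + ereal (1 / (2 * \<gamma>) * (norm (y - x))\<^sup>2)"
proof -
  let ?h = "\<lambda>y. f y + ereal (1 / (2 * \<gamma>) * (norm (y - x))\<^sup>2)"
  obtain p where "\<And>y. ?h p \<le> ?h y"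
    using prox_objective_attains_min[OF assms, of x] by (meson order_trans)
  then have "is_arg_min ?h (\<lambda>_. True) p" by (auto simp: is_arg_min_linorder)
  then have "is_arg_min ?h (\<lambda>_. True) (prox \<gamma> f x)"
    unfolding prox_def arg_min_def by (rule someI)
  then show ?thesis by (auto simp: is_arg_min_linorder)
qed

text \<open>The first-order optimality condition of the proximal problem: compare the minimizer with
  points of the segment towards \<open>y\<close>, divide by the step \<open>t\<close> and let
  \<open>t\<close> tend to 0.\<close>

lemma prox_subgradient:
  fixes f :: "'a::{real_inner, complete_space} \<Rightarrow> ereal"
  assumes f: "closed_fun f" "proper_fun f" "convex_fun f"
    and sub: "subdifferential f w \<noteq> {}" and gamma: "\<gamma> > 0"
  shows "(1 / \<gamma>) *\<^sub>R (x - prox \<gamma> f x) \<in> subdifferential f (prox \<gamma> f x)"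
proof -
  define p where "p = prox \<gamma> f x"
  have min: "f p + ereal (1 / (2 * \<gamma>) * (norm (p - x))\<^sup>2)
      \<le> f y + ereal (1 / (2 * \<gamma>) * (norm (y - x))\<^sup>2)" for y
    unfolding p_def using prox_minimizes[OF f sub gamma] .
  obtain y0 where "f y0 \<noteq> \<infinity>" using f(2) unfolding proper_fun_def by blast
  then have "f p \<noteq> \<infinity>" using min[of y0] by auto
  moreover have "f p \<noteq> -\<infinity>" using f(2) unfolding proper_fun_def by blast
  ultimately obtain a where a: "f p = ereal a" by (cases "f p") auto
  have "f p + ereal ((y - p) \<bullet> ((1 / \<gamma>) *\<^sub>R (x - p))) \<le> f y" for y
  proof (cases "f y")
    case (real b)
    \<comment> \<open>The quadratic contributes a linear term in \<open>t\<close>, which yields the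
      subgradient, and a term of order \<open>t\<close> squared, which leaves an error of order
      \<open>t\<close> after division.\<close>
    have t: "a + (y - p) \<bullet> (x - p) / \<gamma> \<le> b + t * ((norm (y - p))\<^sup>2 / (2 * \<gamma>))"
      if "0 < t" "t < 1" for t
    proof -
      let ?q = "(1 - t) *\<^sub>R p + t *\<^sub>R y"
      have "f ?q \<le> ereal (1 - t) * f p + ereal t * f y"
        using f(3) that unfolding convex_fun_def by blast
      then have q: "f ?q \<le> ereal ((1 - t) * a + t * b)" using a real by simp
      have "ereal (a + 1 / (2 * \<gamma>) * (norm (p - x))\<^sup>2) \<le> f ?q + ereal (1 / (2 * \<gamma>) * (norm (?q - x))\<^sup>2)"
        using min[of ?q] a by simp
      also have "\<dots> \<le> ereal ((1 - t) * a + t * b) + ereal (1 / (2 * \<gamma>) * (norm (?q - x))\<^sup>2)"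
        using q by (rule add_right_mono)
      finally have upper: "a + 1 / (2 * \<gamma>) * (norm (p - x))\<^sup>2
          \<le> (1 - t) * a + t * b + 1 / (2 * \<gamma>) * (norm (?q - x))\<^sup>2" by simp
      have q_norm: "(norm (?q - x))\<^sup>2
          = (norm (p - x))\<^sup>2 - 2 * t * ((y - p) \<bullet> (x - p)) + t\<^sup>2 * (norm (y - p))\<^sup>2"
      proof -
        have "?q - x = t *\<^sub>R (y - p) - (x - p)" by (simp add: algebra_simps)
        then show ?thesis
          unfolding power2_norm_eq_inner
          by (simp add: inner_diff_left inner_diff_right inner_commute algebra_simps power2_eq_square)
      qed
      have "1 / (2 * \<gamma>) * (norm (?q - x))\<^sup>2 = 1 / (2 * \<gamma>) * (norm (p - x))\<^sup>2
          - t * ((y - p) \<bullet> (x - p) / \<gamma>) + t * (t * ((norm (y - p))\<^sup>2 / (2 * \<gamma>)))"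
        unfolding q_norm using gamma by (simp add: field_simps power2_eq_square)
      with upper have "t * (a + (y - p) \<bullet> (x - p) / \<gamma>)
          \<le> t * (b + t * ((norm (y - p))\<^sup>2 / (2 * \<gamma>)))"
        unfolding distrib_left left_diff_distrib by linarith
      then show ?thesis using that by simp
    qed
    have "((\<lambda>t. b + t * ((norm (y - p))\<^sup>2 / (2 * \<gamma>))) \<longlongrightarrow> b + 0 * ((norm (y - p))\<^sup>2 / (2 * \<gamma>)))
        (at_right 0)"
      by (intro tendsto_intros)
    moreover have "eventually (\<lambda>t. a + (y - p) \<bullet> (x - p) / \<gamma>
        \<le> b + t * ((norm (y - p))\<^sup>2 / (2 * \<gamma>))) (at_right 0)"
      using t unfolding eventually_at_right_field by (intro exI[of _ 1]) auto
    ultimately have "a + (y - p) \<bullet> (x - p) / \<gamma> \<le> b + 0 * ((norm (y - p))\<^sup>2 / (2 * \<gamma>))"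
      by (intro tendsto_lowerbound) auto
    then show ?thesis using a real by simp
  qed (use f(2) in \<open>auto simp: proper_fun_def\<close>)
  then show ?thesis unfolding subdifferential_def p_def by simp
qed

section \<open>Nonexpansive reflections and the iteration\<close>

text \<open>Adding the subgradient inequalities at the two proximal points gives monotonicity of the
  subdifferential. The squared distance of the reflections differs from that of \<open>x\<close> and
  \<open>y\<close> by exactly four times this nonpositive term.\<close>

lemma refl_op_nonexpansive:
  fixes f :: "'a::{real_inner, complete_space} \<Rightarrow> ereal"
  assumes f: "closed_fun f" "proper_fun f" "convex_fun f"
    and sub: "subdifferential f w \<noteq> {}" and gamma: "\<gamma> > 0"
  shows "norm (refl_op \<gamma> f x - refl_op \<gamma> f y) \<le> norm (x - y)"
proof -
  define p q where "p = prox \<gamma> f x" and "q = prox \<gamma> f y"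
  have u: "(1 / \<gamma>) *\<^sub>R (x - p) \<in> subdifferential f p"
    and v: "(1 / \<gamma>) *\<^sub>R (y - q) \<in> subdifferential f q"
    unfolding p_def q_def using prox_subgradient[OF assms] by blast+
  obtain a where a: "f p = ereal a" using subdifferential_finite[OF f(2) u] .
  obtain b where b: "f q = ereal b" using subdifferential_finite[OF f(2) v] .
  have "a + (q - p) \<bullet> (x - p) / \<gamma> \<le> b" "b + (p - q) \<bullet> (y - q) / \<gamma> \<le> a"
    using subdifferentialD[OF u a, of q b] subdifferentialD[OF v b, of p a] a b by simp_all
  then have "(q - p) \<bullet> (x - p) / \<gamma> + (p - q) \<bullet> (y - q) / \<gamma> \<le> 0" by linarith
  then have "(q - p) \<bullet> (x - p) + (p - q) \<bullet> (y - q) \<le> 0"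
    using gamma by (simp add: field_simps)
  then have "(norm (x - y))\<^sup>2 + 4 * ((q - p) \<bullet> (x - p) + (p - q) \<bullet> (y - q)) \<le> (norm (x - y))\<^sup>2"
    by simp
  moreover have "(norm ((2 *\<^sub>R p - x) - (2 *\<^sub>R q - y)))\<^sup>2
      = (norm (x - y))\<^sup>2 + 4 * ((q - p) \<bullet> (x - p) + (p - q) \<bullet> (y - q))"
    unfolding power2_norm_eq_inner
    by (simp add: inner_diff_left inner_diff_right inner_commute algebra_simps)
  ultimately have "(norm ((2 *\<^sub>R p - x) - (2 *\<^sub>R q - y)))\<^sup>2 \<le> (norm (x - y))\<^sup>2" by (simp only:)
  then show ?thesis
    unfolding refl_op_def p_def[symmetric] q_def[symmetric] by (rule power2_le_imp_le) simp
qed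

text \<open>Shows the displacement as twice the gap between the two proximal points, so that at a
  fixed point they coincide.\<close>

lemma T_PRS_eq:
  "T_PRS \<gamma> f g x = x + 2 *\<^sub>R (prox \<gamma> f (refl_op \<gamma> g x) - prox \<gamma> g x)"
  by (simp add: T_PRS_def refl_op_def scaleR_diff_right)

text \<open>Each weighted gap is half a step of \<open>z\<close>; thus bounding the averaged gap
  reduces to bounding the total displacement.\<close>

lemma telescoped_gap:
  fixes z :: "nat \<Rightarrow> 'a::real_inner"
  assumes "\<And>k. z (Suc k) = z k + (2 * lam k) *\<^sub>R d k"
  shows "(\<Sum>i=0..k. lam i *\<^sub>R d i) = (1/2) *\<^sub>R (z (Suc k) - z 0)"
proof (induction k)
  case (Suc k)
  then show ?case using assms[of "Suc k"] by (simp add: algebra_simps)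
qed (simp add: assms)

lemma ergodic_avg_diff:
  "ergodic_avg lam x k - ergodic_avg lam y k = ergodic_avg lam (\<lambda>i. x i - y i) k"
  by (simp add: ergodic_avg_def sum_subtractf algebra_simps)

lemma convex_fun_ergodic_avg_le:
  assumes "convex_fun f" "\<And>k. 0 < lam k" "\<And>i. f (x i) \<le> ereal (r i)"
  shows "f (ergodic_avg lam x k) \<le> ereal ((\<Sum>i=0..k. lam i * r i) / cum_weight lam k)"
proof -
  have L: "cum_weight lam k > 0"
    unfolding cum_weight_def by (intro sum_pos) (use assms in auto)
  have "f (\<Sum>i=0..k. (lam i / cum_weight lam k) *\<^sub>R x i)
      \<le> ereal (\<Sum>i=0..k. lam i / cum_weight lam k * r i)"
  proof (rule convex_fun_sum_le)
    show "(\<Sum>i=0..k. lam i / cum_weight lam k) = 1"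
      using L by (simp add: sum_divide_distrib[symmetric] cum_weight_def)
  qed (use assms L in \<open>auto simp: less_imp_le\<close>)
  then show ?thesis
    by (simp add: ergodic_avg_def scaleR_sum_right sum_divide_distrib)
qed

theorem theorem6:
  fixes f g :: "'a::{real_inner, complete_space} \<Rightarrow> ereal"
    and \<gamma> :: real
    and lam :: "nat \<Rightarrow> real"
    and z :: "nat \<Rightarrow> 'a"
    and zstar xstar :: 'a
  assumes f: "closed_fun f" "proper_fun f" "convex_fun f"
    and g: "closed_fun g" "proper_fun g" "convex_fun g"
    and zer_nonempty: "zer (\<lambda>x. subdifferential f x + subdifferential g x) \<noteq> {}"
    and gamma_pos: "\<gamma> > 0"
    and relax: "\<And>k. 0 < lam k \<and> lam k \<le> 1"
    and iter: "\<And>k. z (Suc k) = (1 - lam k) *\<^sub>R z k + lam k *\<^sub>R T_PRS \<gamma> f g (z k)"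
    and zstar: "T_PRS \<gamma> f g zstar = zstar"
    and xstar: "xstar = prox \<gamma> g zstar"
  shows "\<forall>k.
      ereal (- (2 * norm (z 0 - zstar) * norm (zstar - xstar)) / (\<gamma> * cum_weight lam k))
        \<le> f (ergodic_avg lam (aux_f \<gamma> f g z) k) + g (ergodic_avg lam (aux_g \<gamma> g z) k)
            - f xstar - g xstar
    \<and> f (ergodic_avg lam (aux_f \<gamma> f g z) k) + g (ergodic_avg lam (aux_g \<gamma> g z) k)
            - f xstar - g xstar
        \<le> ereal (1 / (4 * \<gamma> * cum_weight lam k) * (norm (z 0 - xstar))\<^sup>2)
    \<and> norm (ergodic_avg lam (aux_g \<gamma> g z) k - ergodic_avg lam (aux_f \<gamma> f g z) k)
        \<le> 2 * norm (z 0 - zstar) / cum_weight lam k"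
proof
  fix k

  \<comment> \<open>Subgradients at the iterates and at the solution\<close>
  obtain w u v where "u \<in> subdifferential f w" "v \<in> subdifferential g w"
    using zer_nonempty unfolding zer_def set_plus_def by auto
  then have subf: "subdifferential f w \<noteq> {}" and subg: "subdifferential g w \<noteq> {}" by auto
  note proxf = prox_subgradient[OF f subf gamma_pos]
  note proxg = prox_subgradient[OF g subg gamma_pos]
  define xg xf d where "xg = aux_g \<gamma> g z" and "xf = aux_f \<gamma> f g z" and "d = (\<lambda>i. xf i - xg i)"
  have lam: "0 < lam i" "lam i \<le> 1" for i using relax by auto
  have L: "cum_weight lam k > 0"
    unfolding cum_weight_def by (intro sum_pos) (use lam in auto)
  have step: "z (Suc i) = z i + (2 * lam i) *\<^sub>R d i" for i
    by (simp add: iter T_PRS_eq d_def xf_def xg_def aux_f_def aux_g_def algebra_simps)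
  have ug: "(1 / \<gamma>) *\<^sub>R (z i - xg i) \<in> subdifferential g (xg i)" for i
    unfolding xg_def aux_g_def by (rule proxg)
  have uf: "(1 / \<gamma>) *\<^sub>R (2 *\<^sub>R xg i - z i - xf i) \<in> subdifferential f (xf i)" for i
    using proxf[of "refl_op \<gamma> g (z i)"]
    by (simp add: xg_def aux_g_def xf_def aux_f_def refl_op_def)
  \<comment> \<open>The fixed-point equation makes \<open>xstar\<close> the proximal point of both
    functions; this produces the opposite subgradients \<open>ugs\<close> and
    \<open>ufs\<close>.\<close>
  have xstar_f: "prox \<gamma> f (refl_op \<gamma> g zstar) = xstar"
    using zstar xstar unfolding T_PRS_eq by simp
  have ugs: "(1 / \<gamma>) *\<^sub>R (zstar - xstar) \<in> subdifferential g xstar"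
    unfolding xstar by (rule proxg)
  have ufs: "(1 / \<gamma>) *\<^sub>R (xstar - zstar) \<in> subdifferential f xstar"
    using proxf[of "refl_op \<gamma> g zstar"] unfolding xstar_f
    by (simp add: refl_op_def xstar[symmetric] scaleR_2)
  obtain a b where ab: "f xstar = ereal a" "g xstar = ereal b"
    using subdifferential_finite[OF f(2) ufs] subdifferential_finite[OF g(2) ugs] by metis
  have "\<exists>r. f (xf i) = ereal r" "\<exists>r. g (xg i) = ereal r" for i
    using subdifferential_finite[OF f(2) uf] subdifferential_finite[OF g(2) ug] by metis+
  then obtain F G where FG: "\<And>i. f (xf i) = ereal (F i)" "\<And>i. g (xg i) = ereal (G i)"
    by metis

  \<comment> \<open>Upper bound: descent, telescoping and Jensen\<close>
  have descent: "4 * \<gamma> * (lam i * (F i + G i - a - b))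
      \<le> (norm (z i - xstar))\<^sup>2 - (norm (z (Suc i) - xstar))\<^sup>2" for i
  proof -
    have "F i + (xstar - xf i) \<bullet> (2 *\<^sub>R xg i - z i - xf i) / \<gamma> \<le> a"
      "G i + (xstar - xg i) \<bullet> (z i - xg i) / \<gamma> \<le> b"
      using subdifferentialD[OF uf FG(1), of xstar a i] subdifferentialD[OF ug FG(2), of xstar b i] ab
      by simp_all
    then have "F i + G i - a - b
        \<le> - ((xstar - xf i) \<bullet> (2 *\<^sub>R xg i - z i - xf i) + (xstar - xg i) \<bullet> (z i - xg i)) / \<gamma>"
      unfolding minus_divide_left[symmetric] add_divide_distrib by linarith
    \<comment> \<open>The vectors \<open>2 *\<^sub>R xg i - z i - xf i\<close> and
      \<open>z i - xg i\<close> sum to \<open>- d i\<close>, so \<open>xstar\<close> enters only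
      through its product with \<open>d i\<close>.\<close>
    also have "- ((xstar - xf i) \<bullet> (2 *\<^sub>R xg i - z i - xf i) + (xstar - xg i) \<bullet> (z i - xg i))
        = d i \<bullet> (xstar - z i) - d i \<bullet> d i"
      by (simp add: d_def inner_diff_left inner_diff_right inner_commute algebra_simps)
    finally have "\<gamma> * (F i + G i - a - b) \<le> d i \<bullet> (xstar - z i) - d i \<bullet> d i"
      using gamma_pos by (simp add: field_simps)
    then have "4 * lam i * (\<gamma> * (F i + G i - a - b))
        \<le> 4 * lam i * (d i \<bullet> (xstar - z i) - d i \<bullet> d i)"
      using lam[of i] by (intro mult_left_mono) auto
    \<comment> \<open>The bound \<open>lam i \<le> 1\<close> is used here: the factor
      \<open>lam i\<close> on \<open>d i \<bullet> d i\<close> is the one that expanding the square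
      of the relaxed step produces.\<close>
    also have "\<dots> \<le> 4 * lam i * (d i \<bullet> (xstar - z i) - lam i * (d i \<bullet> d i))"
      using lam[of i] by (intro mult_left_mono) (auto intro: mult_left_le_one_le)
    also have "\<dots> = (norm (z i - xstar))\<^sup>2 - (norm (z (Suc i) - xstar))\<^sup>2"
      unfolding step power2_norm_eq_inner
      by (simp add: inner_add_left inner_add_right inner_diff_left inner_diff_right
          inner_commute algebra_simps)
    finally show ?thesis by (simp add: algebra_simps)
  qed
  have "4 * \<gamma> * (\<Sum>i=0..k. lam i * (F i + G i - a - b))
      \<le> (\<Sum>i=0..k. (norm (z i - xstar))\<^sup>2 - (norm (z (Suc i) - xstar))\<^sup>2)"
    unfolding sum_distrib_left by (intro sum_mono descent)
  also have "\<dots> = (norm (z 0 - xstar))\<^sup>2 - (norm (z (Suc k) - xstar))\<^sup>2"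
    by (induction k) auto
  finally have sum_le: "4 * \<gamma> * (\<Sum>i=0..k. lam i * (F i + G i - a - b)) \<le> (norm (z 0 - xstar))\<^sup>2"
    by (smt (verit) zero_le_power2)

  define A B where "A = ergodic_avg lam xf k" and "B = ergodic_avg lam xg k"
  define SF SG where "SF = (\<Sum>i=0..k. lam i * F i) / cum_weight lam k"
    and "SG = (\<Sum>i=0..k. lam i * G i) / cum_weight lam k"
  have fA: "f A \<le> ereal SF" and gB: "g B \<le> ereal SG"
    unfolding A_def B_def SF_def SG_def
    by (intro convex_fun_ergodic_avg_le f g lam; simp add: FG)+
  \<comment> \<open>Jensen bounds both values from above and properness excludes minus infinity, so
    the objective error becomes real arithmetic.\<close>
  obtain fa gb where fagb: "f A = ereal fa" "g B = ereal gb"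
    using fA gB f(2) g(2) unfolding proper_fun_def by (cases "f A"; cases "g B") auto
  have le: "fa \<le> SF" "gb \<le> SG" using fA gB fagb by simp_all
  have "(\<Sum>i=0..k. lam i * (F i + G i - a - b)) = (SF + SG - a - b) * cum_weight lam k"
  proof -
    have "(\<Sum>i=0..k. lam i * (F i + G i - a - b))
        = (\<Sum>i=0..k. lam i * F i) + (\<Sum>i=0..k. lam i * G i) - (a + b) * cum_weight lam k"
      unfolding cum_weight_def sum_distrib_left
      by (simp add: sum.distrib[symmetric] sum_subtractf[symmetric] algebra_simps)
    also have "\<dots> = SF * cum_weight lam k + SG * cum_weight lam k - (a + b) * cum_weight lam k"
      using L by (simp add: SF_def SG_def)
    finally show ?thesis by (simp only: left_diff_distrib distrib_right)
  qed
  with sum_le have "4 * \<gamma> * ((SF + SG - a - b) * cum_weight lam k) \<le> (norm (z 0 - xstar))\<^sup>2"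
    by (simp only:)
  then have "SF + SG - a - b \<le> 1 / (4 * \<gamma> * cum_weight lam k) * (norm (z 0 - xstar))\<^sup>2"
    using L gamma_pos by (simp add: pos_le_divide_eq mult_ac)
  then have upper: "fa + gb - a - b \<le> 1 / (4 * \<gamma> * cum_weight lam k) * (norm (z 0 - xstar))\<^sup>2"
    using le by linarith

  \<comment> \<open>Fejer monotonicity and the feasibility bound\<close>
  have T: "norm (T_PRS \<gamma> f g x - zstar) \<le> norm (x - zstar)" for x
    using refl_op_nonexpansive[OF f subf gamma_pos, of "refl_op \<gamma> g x" "refl_op \<gamma> g zstar"]
      refl_op_nonexpansive[OF g subg gamma_pos, of x zstar] zstar
    by (simp add: T_PRS_def)
  \<comment> \<open>The next iterate is a convex combination of \<open>z n\<close> and its image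
    under \<open>T_PRS\<close>, and neither is farther from the fixed point than
    \<open>z n\<close>.\<close>
  have fejer: "norm (z n - zstar) \<le> norm (z 0 - zstar)" for n
  proof (induction n)
    case (Suc n)
    have "z (Suc n) - zstar
        = (1 - lam n) *\<^sub>R (z n - zstar) + lam n *\<^sub>R (T_PRS \<gamma> f g (z n) - zstar)"
      by (simp add: iter algebra_simps)
    also have "norm \<dots> \<le> (1 - lam n) * norm (z n - zstar) + lam n * norm (T_PRS \<gamma> f g (z n) - zstar)"
      using lam[of n] by (intro norm_triangle_le) simp
    also have "\<dots> \<le> (1 - lam n) * norm (z n - zstar) + lam n * norm (z n - zstar)"
      using T[of "z n"] lam[of n] by (intro add_left_mono mult_left_mono) auto
    finally show ?case using Suc by (simp add: algebra_simps)
  qed simp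
  have "A - B = (1 / (2 * cum_weight lam k)) *\<^sub>R (z (Suc k) - z 0)"
    unfolding A_def B_def ergodic_avg_diff
    using telescoped_gap[of z lam d k, OF step] by (simp add: ergodic_avg_def d_def)
  then have "norm (B - A) = norm (z (Suc k) - z 0) / (2 * cum_weight lam k)"
    using L by (simp add: norm_minus_commute[of B])
  \<comment> \<open>The triangle inequality and \<open>fejer\<close> give the factor 2; the coarser
    4 matches the constant of the claim after division by
    \<open>2 * cum_weight lam k\<close>.\<close>
  also have "\<dots> \<le> 4 * norm (z 0 - zstar) / (2 * cum_weight lam k)"
  proof (rule divide_right_mono)
    have "norm (z (Suc k) - z 0) \<le> norm (z (Suc k) - zstar) + norm (z 0 - zstar)"
      using norm_triangle_ineq4[of "z (Suc k) - zstar" "z 0 - zstar"] by simp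
    then show "norm (z (Suc k) - z 0) \<le> 4 * norm (z 0 - zstar)"
      using fejer[of "Suc k"] norm_ge_zero[of "z 0 - zstar"] by linarith
  qed (use L in simp)
  finally have feas: "norm (B - A) \<le> 2 * norm (z 0 - zstar) / cum_weight lam k" by simp

  \<comment> \<open>Lower bound from the subgradients at the solution\<close>
  have "a + (A - xstar) \<bullet> (xstar - zstar) / \<gamma> \<le> fa" "b + (B - xstar) \<bullet> (zstar - xstar) / \<gamma> \<le> gb"
    using subdifferentialD[OF ufs ab(1), of A fa] subdifferentialD[OF ugs ab(2), of B gb] fagb
    by simp_all
  \<comment> \<open>Because the two subgradients are opposite, \<open>xstar\<close> cancels in the
    first factors and only the gap \<open>B - A\<close> remains, which \<open>feas\<close> and
    Cauchy-Schwarz control.\<close>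
  moreover have "(A - xstar) \<bullet> (xstar - zstar) / \<gamma> + (B - xstar) \<bullet> (zstar - xstar) / \<gamma>
      = (B - A) \<bullet> (zstar - xstar) / \<gamma>"
    by (simp add: inner_diff_left inner_diff_right add_divide_distrib[symmetric])
  ultimately have "(B - A) \<bullet> (zstar - xstar) / \<gamma> \<le> fa + gb - a - b" by linarith
  moreover have "- (2 * norm (z 0 - zstar) * norm (zstar - xstar)) / (\<gamma> * cum_weight lam k)
      \<le> (B - A) \<bullet> (zstar - xstar) / \<gamma>"
  proof -
    have "- ((B - A) \<bullet> (zstar - xstar)) \<le> norm (B - A) * norm (zstar - xstar)"
      using Cauchy_Schwarz_ineq2[of "B - A" "zstar - xstar"] by linarith
    also have "\<dots> \<le> 2 * norm (z 0 - zstar) / cum_weight lam k * norm (zstar - xstar)"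
      using feas by (intro mult_right_mono) auto
    finally show ?thesis using gamma_pos L by (simp add: field_simps)
  qed
  ultimately have lower: "- (2 * norm (z 0 - zstar) * norm (zstar - xstar)) / (\<gamma> * cum_weight lam k)
      \<le> fa + gb - a - b" by linarith
  show "ereal (- (2 * norm (z 0 - zstar) * norm (zstar - xstar)) / (\<gamma> * cum_weight lam k))
        \<le> f (ergodic_avg lam (aux_f \<gamma> f g z) k) + g (ergodic_avg lam (aux_g \<gamma> g z) k)
            - f xstar - g xstar
    \<and> f (ergodic_avg lam (aux_f \<gamma> f g z) k) + g (ergodic_avg lam (aux_g \<gamma> g z) k)
            - f xstar - g xstar
        \<le> ereal (1 / (4 * \<gamma> * cum_weight lam k) * (norm (z 0 - xstar))\<^sup>2)
    \<and> norm (ergodic_avg lam (aux_g \<gamma> g z) k - ergodic_avg lam (aux_f \<gamma> f g z) k)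
        \<le> 2 * norm (z 0 - zstar) / cum_weight lam k"
    using lower upper feas fagb ab unfolding A_def B_def xf_def xg_def by simp
qed

end
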